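(* The group $G$, with its ind-Zariski topology, is connected and hence irreducible.
   Context: $R=\mathbb{C}\langle x,y\rangle$ is the free associative $\mathbb{C}$-algebra on $x,y$, and $G$ is the group of all $\mathbb{C}$-algebra automorphisms $\sigma$ of $R$ with $\sigma([x,y])=[x,y]$, viewed as a subset of $R\times R$ via $\sigma\mapsto(\sigma(x),\sigma(y))$. Let $R^{(k)}$ be the finite-dimensional space of elements of $R$ of degree $\le k$ in $x,y$, and put $G^{(k)}=G\cap(R^{(k)}\times R^{(k)})$, which is Zariski closed in $R^{(k)}\times R^{(k)}$. The ind-variety structure on $G$ is given by the filtration $\{G^{(k)}\}$ by closed (reduced) subvarieties; a subset $S\subseteq G$ is closed iff $S\cap G^{(k)}$ is Zariski closed in $G^{(k)}$ for all $k$. Irreducible means irreducible as a topological space. *)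

theory Defs
  imports "HOL-Analysis.Abstract_Topology" "HOL-Library.Poly_Mapping"
begin

datatype letter = Lx | Ly

text \<open>Words form the free monoid on two letters. It is written additively (addition is
  concatenation) because the monoid algebra provided by \<^type>\<open>poly_mapping\<close> is
  indexed by additive monoids; the multiplication there is convolution and is not commutative
  here. A separate type avoids class instances on \<^type>\<open>list\<close> itself.\<close>

datatype mon = Mon (letters: "letter list")

instantiation mon :: monoid_add
begin

definition zero_mon :: mon where "0 = Mon []"

definition plus_mon :: "mon \<Rightarrow> mon \<Rightarrow> mon" where
  "u + v = Mon (letters u @ letters v)"

instance
  by standard (simp_all add: zero_mon_def plus_mon_def)

end

type_synonym falg = "mon \<Rightarrow>\<^sub>0 complex"

definition gx :: falg where "gx = Poly_Mapping.single (Mon [Lx]) 1"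

definition gy :: falg where "gy = Poly_Mapping.single (Mon [Ly]) 1"

definition scale :: "complex \<Rightarrow> falg \<Rightarrow> falg" where
  "scale c f = Poly_Mapping.map ((*) c) f"

lemma lookup_scale [simp]:
  "Poly_Mapping.lookup (scale c f) w = c * Poly_Mapping.lookup f w"
  by (simp add: scale_def Poly_Mapping.map.rep_eq when_def)

interpretation falg: vector_space scale
  by standard (auto intro!: poly_mapping_eqI simp: lookup_add algebra_simps)

lemma scale_conv_mult: "scale c f = Poly_Mapping.single 0 c * f"
proof (rule poly_mapping_eqI)
  fix w
  have eq: "(c when k = (0::mon)) * t = (c * t when k = 0)" for k t
    by (simp add: when_def)
  have inner: "Sum_any (\<lambda>q. Poly_Mapping.lookup f q when w = q) = Poly_Mapping.lookup f w"
    by simp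
  show "Poly_Mapping.lookup (scale c f) w = Poly_Mapping.lookup (Poly_Mapping.single 0 c * f) w"
    unfolding lookup_mult lookup_single lookup_scale
    by (simp add: when_mult inner eq_commute[of "0::mon"])
qed

definition alg_aut :: "(falg \<Rightarrow> falg) \<Rightarrow> bool" where
  "alg_aut \<sigma> \<longleftrightarrow>
     bij \<sigma> \<and> Vector_Spaces.linear scale scale \<sigma> \<and> \<sigma> 1 = 1 \<and> (\<forall>f g. \<sigma> (f * g) = \<sigma> f * \<sigma> g)"

definition commutator :: "falg \<Rightarrow> falg \<Rightarrow> falg" where
  "commutator f g = f * g - g * f"

definition autG :: "(falg \<Rightarrow> falg) set" where
  "autG = {\<sigma>. alg_aut \<sigma> \<and> \<sigma> (commutator gx gy) = commutator gx gy}"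

text \<open>The group viewed as a subset of pairs; an automorphism is determined by the images
  of the two generators.\<close>

definition G :: "(falg \<times> falg) set" where
  "G = (\<lambda>\<sigma>. (\<sigma> gx, \<sigma> gy)) ` autG"

lemma id_in_autG: "id \<in> autG"
  by (simp add: autG_def alg_aut_def falg.linear_id)

lemma G_nonempty: "(gx, gy) \<in> G"
  unfolding G_def using id_in_autG by (rule rev_image_eqI) simp

text \<open>Degree at most \<open>k\<close>; the zero element has no keys and so belongs to every \<open>R_le k\<close>.\<close>

definition R_le :: "nat \<Rightarrow> falg set" where
  "R_le k = {f. \<forall>w\<in>Poly_Mapping.keys f. length (letters w) \<le> k}"

definition V_le :: "nat \<Rightarrow> (falg \<times> falg) set" where
  "V_le k = R_le k \<times> R_le k"

definition G_le :: "nat \<Rightarrow> (falg \<times> falg) set" where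
  "G_le k = G \<inter> V_le k"

text \<open>Polynomial functions on the finite-dimensional space \<open>V_le k\<close>: the algebra of functions
  generated by the constants and the coordinate functions, which are the coefficients of the
  two components at the words of length at most \<open>k\<close>. Only the values on \<open>V_le k\<close> matter.\<close>

inductive_set poly_fun :: "nat \<Rightarrow> (falg \<times> falg \<Rightarrow> complex) set" for k where
  const: "(\<lambda>p. c) \<in> poly_fun k"
| coord_fst: "length (letters w) \<le> k \<Longrightarrow> (\<lambda>p. Poly_Mapping.lookup (fst p) w) \<in> poly_fun k"
| coord_snd: "length (letters w) \<le> k \<Longrightarrow> (\<lambda>p. Poly_Mapping.lookup (snd p) w) \<in> poly_fun k"
| add: "P \<in> poly_fun k \<Longrightarrow> Q \<in> poly_fun k \<Longrightarrow> (\<lambda>p. P p + Q p) \<in> poly_fun k"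
| mult: "P \<in> poly_fun k \<Longrightarrow> Q \<in> poly_fun k \<Longrightarrow> (\<lambda>p. P p * Q p) \<in> poly_fun k"

definition zero_locus :: "nat \<Rightarrow> (falg \<times> falg \<Rightarrow> complex) set \<Rightarrow> (falg \<times> falg) set" where
  "zero_locus k F = {p \<in> V_le k. \<forall>P\<in>F. P p = 0}"

definition zariski_closed :: "nat \<Rightarrow> (falg \<times> falg) set \<Rightarrow> bool" where
  "zariski_closed k Z \<longleftrightarrow> (\<exists>F\<subseteq>poly_fun k. Z = zero_locus k F)"

definition zariski :: "nat \<Rightarrow> (falg \<times> falg) topology" where
  "zariski k = topology (\<lambda>U. U \<subseteq> V_le k \<and> zariski_closed k (V_le k - U))"

definition ind_closed :: "(falg \<times> falg) set \<Rightarrow> bool" where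
  "ind_closed S \<longleftrightarrow>
     S \<subseteq> G \<and> (\<forall>k. closedin (subtopology (zariski k) (G_le k)) (S \<inter> G_le k))"

definition ind_zariski_G :: "(falg \<times> falg) topology" where
  "ind_zariski_G = topology (\<lambda>U. U \<subseteq> G \<and> ind_closed (G - U))"

definition irreducible_space :: "'a topology \<Rightarrow> bool" where
  "irreducible_space T \<longleftrightarrow>
     topspace T \<noteq> {} \<and>
     (\<forall>A B. closedin T A \<and> closedin T B \<and> A \<union> B = topspace T \<longrightarrow>
            A = topspace T \<or> B = topspace T)"

text \<open>\<^const>\<open>topology\<close> is unspecified on set systems that are not topologies, so the
  two uses above are justified here.\<close>

lemma istopology_from_closed:
  assumes empty: "C {}"
    and Un: "\<And>A B. C A \<Longrightarrow> C B \<Longrightarrow> C (A \<union> B)"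
    and Int: "\<And>\<K>. (\<And>A. A \<in> \<K> \<Longrightarrow> A \<subseteq> V \<and> C A) \<Longrightarrow> C (V \<inter> \<Inter>\<K>)"
  shows "istopology (\<lambda>U. U \<subseteq> V \<and> C (V - U))"
  unfolding istopology_def
proof (intro conjI allI impI)
  fix S T assume S: "S \<subseteq> V \<and> C (V - S)" and T: "T \<subseteq> V \<and> C (V - T)"
  show "S \<inter> T \<subseteq> V" using S by blast
  show "C (V - S \<inter> T)" using Un[of "V - S" "V - T"] S T by (simp add: Diff_Int)
next
  fix \<K> assume K: "\<forall>K\<in>\<K>. K \<subseteq> V \<and> C (V - K)"
  show "\<Union>\<K> \<subseteq> V" using K by blast
  have "C (V \<inter> \<Inter>((\<lambda>K. V - K) ` \<K>))" using K by (intro Int) auto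
  moreover have "V \<inter> \<Inter>((\<lambda>K. V - K) ` \<K>) = V - \<Union>\<K>" by auto
  ultimately show "C (V - \<Union>\<K>)" by simp
qed

lemma zariski_closed_empty: "zariski_closed k {}"
  unfolding zariski_closed_def zero_locus_def
  by (rule exI[of _ "{\<lambda>p. 1}"]) (auto intro: poly_fun.const)

lemma zariski_closed_Un:
  assumes "zariski_closed k A" and "zariski_closed k B"
  shows "zariski_closed k (A \<union> B)"
proof -
  obtain F H where F: "F \<subseteq> poly_fun k" "A = zero_locus k F"
    and H: "H \<subseteq> poly_fun k" "B = zero_locus k H"
    using assms unfolding zariski_closed_def by blast
  let ?M = "{\<lambda>p. P p * Q p |P Q. P \<in> F \<and> Q \<in> H}"
  have "?M \<subseteq> poly_fun k" using F H by (auto intro: poly_fun.mult)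
  moreover have "A \<union> B = zero_locus k ?M"
    unfolding F H zero_locus_def by (auto 4 4)
  ultimately show ?thesis unfolding zariski_closed_def by blast
qed

lemma zariski_closed_Inter:
  assumes "\<And>A. A \<in> \<K> \<Longrightarrow> A \<subseteq> V_le k \<and> zariski_closed k A"
  shows "zariski_closed k (V_le k \<inter> \<Inter>\<K>)"
proof -
  obtain F where F: "\<And>A. A \<in> \<K> \<Longrightarrow> F A \<subseteq> poly_fun k \<and> A = zero_locus k (F A)"
    using assms unfolding zariski_closed_def by metis
  have "(\<Union>A\<in>\<K>. F A) \<subseteq> poly_fun k" using F by blast
  moreover have "V_le k \<inter> \<Inter>\<K> = zero_locus k (\<Union>A\<in>\<K>. F A)"
  proof -
    have "p \<in> A \<longleftrightarrow> p \<in> V_le k \<and> (\<forall>P\<in>F A. P p = 0)" if "A \<in> \<K>" for p A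
      using F[OF that] unfolding zero_locus_def by blast
    then show ?thesis unfolding zero_locus_def by blast
  qed
  ultimately show ?thesis unfolding zariski_closed_def by blast
qed

lemma openin_zariski:
  "openin (zariski k) U \<longleftrightarrow> U \<subseteq> V_le k \<and> zariski_closed k (V_le k - U)"
  unfolding zariski_def
  by (simp add: topology_inverse' istopology_from_closed zariski_closed_empty
      zariski_closed_Un zariski_closed_Inter)

lemma topspace_zariski: "topspace (zariski k) = V_le k"
  unfolding topspace_def openin_zariski using zariski_closed_empty[of k]
  by (intro subset_antisym Union_least Union_upper) auto

lemma closedin_zariski: "closedin (zariski k) Z \<longleftrightarrow> zariski_closed k Z"
proof -
  have "zariski_closed k Z \<Longrightarrow> Z \<subseteq> V_le k"
    unfolding zariski_closed_def zero_locus_def by blast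
  then show ?thesis
    unfolding closedin_def topspace_zariski openin_zariski
    by (auto simp: double_diff)
qed

lemma ind_closed_empty: "ind_closed {}"
  by (simp add: ind_closed_def)

lemma ind_closed_Un: "ind_closed A \<Longrightarrow> ind_closed B \<Longrightarrow> ind_closed (A \<union> B)"
  by (simp add: ind_closed_def Int_Un_distrib2 closedin_Un)

lemma ind_closed_Inter:
  assumes "\<And>A. A \<in> \<K> \<Longrightarrow> A \<subseteq> G \<and> ind_closed A"
  shows "ind_closed (G \<inter> \<Inter>\<K>)"
  unfolding ind_closed_def
proof (intro conjI allI)
  fix k
  let ?T = "subtopology (zariski k) (G_le k)"
  have top: "topspace ?T = G_le k"
    by (auto simp: topspace_zariski G_le_def)
  have "closedin ?T (\<Inter>(insert (G_le k) ((\<lambda>A. A \<inter> G_le k) ` \<K>)))"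
    using assms top closedin_topspace[of ?T]
    by (intro closedin_Inter) (auto simp: ind_closed_def)
  moreover have "\<Inter>(insert (G_le k) ((\<lambda>A. A \<inter> G_le k) ` \<K>)) = G \<inter> \<Inter>\<K> \<inter> G_le k"
    by (auto simp: G_le_def)
  ultimately show "closedin ?T (G \<inter> \<Inter>\<K> \<inter> G_le k)" by simp
qed simp

lemma openin_ind_zariski_G:
  "openin ind_zariski_G U \<longleftrightarrow> U \<subseteq> G \<and> ind_closed (G - U)"
  unfolding ind_zariski_G_def
  by (simp add: topology_inverse' istopology_from_closed ind_closed_empty
      ind_closed_Un ind_closed_Inter)

lemma topspace_ind_zariski_G: "topspace ind_zariski_G = G"
  unfolding topspace_def openin_ind_zariski_G using ind_closed_empty
  by (intro subset_antisym Union_least Union_upper) auto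

lemma closedin_ind_zariski_G: "closedin ind_zariski_G S \<longleftrightarrow> ind_closed S"
proof -
  have "ind_closed S \<Longrightarrow> S \<subseteq> G"
    by (simp add: ind_closed_def)
  then show ?thesis
    unfolding closedin_def topspace_ind_zariski_G openin_ind_zariski_G
    by (auto simp: double_diff)
qed

end

theory Submission
  imports Defs "HOL-Computational_Algebra.Polynomial"
begin

text \<open>Any two points of \<^term>\<open>G\<close> lie on one affine line mapped polynomially into
  \<^term>\<open>G\<close>. Irreducibility is a formal consequence: if \<open>A \<union> B = G\<close> with both sets closed,
  \<open>g \<notin> A\<close> and \<open>h \<notin> B\<close>, choose such a line through \<open>g\<close> and \<open>h\<close>. It stays in bounded degree, so
  polynomial functions vanishing on \<open>A\<close> but not at \<open>g\<close>, and on \<open>B\<close> but not at \<open>h\<close>, pull back to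
  two nonzero polynomials in one variable whose product vanishes identically, which is absurd.
  An irreducible space is connected.

  The lines come from an Alexander trick. Let \<open>\<sigma>\<close> preserve the commutator. Precomposing with a
  translation \<open>x \<mapsto> x + a, y \<mapsto> y + b\<close> removes the constant terms of \<open>\<sigma>(x)\<close> and \<open>\<sigma>(y)\<close>, and
  translations form a line. If \<open>\<sigma>\<close> has no constant terms, conjugate it by the dilation
  \<open>\<delta>\<^sub>t\<close> that multiplies both generators by \<open>t\<close>: then
  \<open>(\<delta>\<^sub>t \<circ> \<sigma> \<circ> \<delta>\<^sub>t\<^sup>-\<^sup>1)(x) = t\<^sup>-\<^sup>1 \<sigma>(x)(tx, ty)\<close> is polynomial in \<open>t\<close>, equals \<open>\<sigma>(x)\<close> at
  \<open>t = 1\<close> and is the linear part of \<open>\<sigma>(x)\<close> at \<open>t = 0\<close>. The dilation scales \<open>[x,y]\<close>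
  by a constant, so the conjugates stay in the group for \<open>t \<noteq> 0\<close>, and by continuity in \<open>t\<close> the
  linear part preserves \<open>[x,y]\<close> too, that is, has determinant \<open>1\<close>
  (\<open>joined_id_origin_preserving\<close>). Finally a matrix of determinant \<open>1\<close> is a product of
  elementary matrices, each of which lies on a line through the identity (\<open>joined_lin\<close>).

  Chains of such lines can be replaced by one line because curves of automorphisms can be
  composed pointwise (\<open>joined_comp\<close>, \<open>joined_trans\<close>).\<close>

section \<open>The free algebra and its substitution homomorphisms\<close>

lemma scale_mult_left: "scale c f * g = scale c (f * g)"
  by (simp add: scale_conv_mult mult.assoc)

lemma update_conv_add:
  "w \<notin> Poly_Mapping.keys f \<Longrightarrow> Poly_Mapping.update w b f = f + Poly_Mapping.single w b"
  by (auto intro!: poly_mapping_eqI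
      simp: lookup_update lookup_add lookup_single in_keys_iff when_def)

text \<open>Scalars are central although the algebra is not commutative.\<close>

lemma single_zero_commutes: "Poly_Mapping.single 0 c * f = f * Poly_Mapping.single (0::mon) c"
  for f :: falg
proof (induction f rule: update_induct)
  case const
  show ?case by simp
next
  case (update f w b)
  then show ?case
    by (simp add: update_conv_add distrib_left distrib_right mult_single mult.commute)
qed

lemma scale_mult_right: "f * scale c g = scale c (f * g)"
  by (metis scale_conv_mult mult.assoc single_zero_commutes)

lemma falg_induct [case_names scalar x y add]:
  assumes scalar: "\<And>c. P (scale c 1)"
    and x: "\<And>f. P f \<Longrightarrow> P (gx * f)"
    and y: "\<And>f. P f \<Longrightarrow> P (gy * f)"
    and add: "\<And>f g. P f \<Longrightarrow> P g \<Longrightarrow> P (f + g)"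
  shows "P f"
proof (induction f rule: update_induct)
  case const
  show ?case using scalar[of 0] by simp
next
  case (update f w b)
  have "P (Poly_Mapping.single (Mon ls) b)" for ls
  proof (induction ls)
    case Nil
    show ?case using scalar[of b] by (simp add: scale_conv_mult zero_mon_def)
  next
    case (Cons l ls)
    have "Poly_Mapping.single (Mon (l # ls)) b =
        (case l of Lx \<Rightarrow> gx | Ly \<Rightarrow> gy) * Poly_Mapping.single (Mon ls) b"
      by (simp add: gx_def gy_def mult_single plus_mon_def split: letter.split)
    then show ?case using Cons x y by (simp split: letter.split)
  qed
  then show ?case
    using update add by (cases w) (auto simp: update_conv_add)
qed

text \<open>A complement of the scalars is the right ideal generated by the two generators. Splitting off a
  left factor \<^term>\<open>gx\<close> or \<^term>\<open>gy\<close> is what later allows division by the parameter of a dilation.\<close>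

lemma falg_decompose: obtains c f1 f2 where "f = scale c 1 + gx * f1 + gy * f2"
proof -
  have "\<exists>c f1 f2. f = scale c 1 + gx * f1 + gy * f2"
  proof (induction f rule: falg_induct)
    case (scalar c)
    show ?case by (rule exI[of _ c], rule exI[of _ 0], rule exI[of _ 0]) simp
  next
    case (x f)
    show ?case by (rule exI[of _ 0], rule exI[of _ f], rule exI[of _ 0]) simp
  next
    case (y f)
    show ?case by (rule exI[of _ 0], rule exI[of _ 0], rule exI[of _ f]) simp
  next
    case (add f g)
    then obtain c f1 f2 d g1 g2 where "f = scale c 1 + gx * f1 + gy * f2"
      "g = scale d 1 + gx * g1 + gy * g2" by blast
    then have "f + g = scale (c + d) 1 + gx * (f1 + g1) + gy * (f2 + g2)"
      by (simp add: falg.scale_left_distrib distrib_left)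
    then show ?case by blast
  qed
  then show ?thesis using that by blast
qed

definition alg_hom :: "(falg \<Rightarrow> falg) \<Rightarrow> bool" where
  "alg_hom \<sigma> \<longleftrightarrow>
     Vector_Spaces.linear scale scale \<sigma> \<and> \<sigma> 1 = 1 \<and> (\<forall>f g. \<sigma> (f * g) = \<sigma> f * \<sigma> g)"

lemma alg_hom_iff:
  "alg_hom \<sigma> \<longleftrightarrow> (\<forall>f g. \<sigma> (f + g) = \<sigma> f + \<sigma> g) \<and> (\<forall>c f. \<sigma> (scale c f) = scale c (\<sigma> f)) \<and>
     \<sigma> 1 = 1 \<and> (\<forall>f g. \<sigma> (f * g) = \<sigma> f * \<sigma> g)"
  unfolding alg_hom_def linear_iff_module_hom module_hom_iff
  by (auto simp: falg.module_axioms)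

lemma alg_aut_iff: "alg_aut \<sigma> \<longleftrightarrow> bij \<sigma> \<and> alg_hom \<sigma>"
  by (auto simp: alg_aut_def alg_hom_def)

context
  fixes \<sigma> assumes hom: "alg_hom \<sigma>"
begin

lemma hom_add: "\<sigma> (f + g) = \<sigma> f + \<sigma> g"
  using hom by (simp add: alg_hom_iff)

lemma hom_scale: "\<sigma> (scale c f) = scale c (\<sigma> f)"
  using hom by (simp add: alg_hom_iff)

lemma hom_one: "\<sigma> 1 = 1"
  using hom by (simp add: alg_hom_iff)

lemma hom_mult: "\<sigma> (f * g) = \<sigma> f * \<sigma> g"
  using hom by (simp add: alg_hom_iff)

lemma hom_diff: "\<sigma> (f - g) = \<sigma> f - \<sigma> g"
  using hom_add[of "f - g" g] by (simp add: algebra_simps)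

lemma hom_commutator: "\<sigma> (commutator f g) = commutator (\<sigma> f) (\<sigma> g)"
  by (simp add: commutator_def hom_diff hom_mult)

lemmas hom_simps = hom_add hom_scale hom_one hom_mult hom_diff hom_commutator

end

lemma alg_hom_id: "alg_hom id"
  by (simp add: alg_hom_iff)

lemma alg_hom_comp: "alg_hom \<sigma> \<Longrightarrow> alg_hom \<tau> \<Longrightarrow> alg_hom (\<sigma> \<circ> \<tau>)"
  by (simp add: alg_hom_iff)

lemma alg_hom_eqI:
  assumes "alg_hom \<sigma>" "alg_hom \<tau>" "\<sigma> gx = \<tau> gx" "\<sigma> gy = \<tau> gy"
  shows "\<sigma> = \<tau>"
proof
  fix f show "\<sigma> f = \<tau> f"
    by (induction f rule: falg_induct) (simp_all add: assms hom_simps)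
qed

fun eval_word :: "falg \<Rightarrow> falg \<Rightarrow> letter list \<Rightarrow> falg" where
  "eval_word p q [] = 1"
| "eval_word p q (l # ls) = (case l of Lx \<Rightarrow> p | Ly \<Rightarrow> q) * eval_word p q ls"

definition subst :: "falg \<Rightarrow> falg \<Rightarrow> falg \<Rightarrow> falg" where
  "subst p q f =
     (\<Sum>w\<in>Poly_Mapping.keys f. scale (Poly_Mapping.lookup f w) (eval_word p q (letters w)))"

text \<open>With the index set decoupled from \<^term>\<open>f\<close>, additivity becomes additivity of coefficients.\<close>

lemma subst_superset:
  assumes "finite K" "Poly_Mapping.keys f \<subseteq> K"
  shows "subst p q f = (\<Sum>w\<in>K. scale (Poly_Mapping.lookup f w) (eval_word p q (letters w)))"
  unfolding subst_def using assms by (intro sum.mono_neutral_left) (auto simp: in_keys_iff)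

lemma subst_add: "subst p q (f + g) = subst p q f + subst p q g"
proof -
  let ?K = "Poly_Mapping.keys f \<union> Poly_Mapping.keys g"
  have "Poly_Mapping.keys (f + g) \<subseteq> ?K" by (rule Poly_Mapping.keys_add)
  then show ?thesis
    by (simp add: subst_superset[of ?K] lookup_add falg.scale_left_distrib sum.distrib)
qed

lemma subst_scale: "subst p q (scale c f) = scale c (subst p q f)"
proof -
  have "Poly_Mapping.keys (scale c f) \<subseteq> Poly_Mapping.keys f"
    by (auto simp: in_keys_iff)
  then show ?thesis
    by (simp add: subst_superset[of "Poly_Mapping.keys f"] falg.scale_sum_right)
qed

lemma subst_single: "subst p q (Poly_Mapping.single w c) = scale c (eval_word p q (letters w))"
  by (simp add: subst_superset[of "{w}"])

lemma subst_one: "subst p q 1 = 1"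
  using subst_single[of p q 0 1] by simp (simp add: zero_mon_def)

lemma subst_single_mult:
  "subst p q (Poly_Mapping.single (Mon [l]) 1 * f) = (case l of Lx \<Rightarrow> p | Ly \<Rightarrow> q) * subst p q f"
proof (induction f rule: update_induct)
  case const
  show ?case by (simp add: subst_def)
next
  case (update f w b)
  then show ?case
    by (simp add: update_conv_add distrib_left subst_add mult_single subst_single plus_mon_def
        scale_mult_right)
qed

lemma subst_gx_mult: "subst p q (gx * f) = p * subst p q f"
  and subst_gy_mult: "subst p q (gy * f) = q * subst p q f"
  unfolding gx_def gy_def by (simp_all add: subst_single_mult)

lemma subst_mult: "subst p q (f * g) = subst p q f * subst p q g"
  by (induction f rule: falg_induct)
    (simp_all add: scale_mult_left subst_scale subst_one mult.assoc subst_gx_mult subst_gy_mult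
      distrib_right subst_add)

lemma alg_hom_subst: "alg_hom (subst p q)"
  by (simp add: alg_hom_iff subst_add subst_scale subst_one subst_mult)

lemma subst_gx [simp]: "subst p q gx = p" and subst_gy [simp]: "subst p q gy = q"
  using subst_gx_mult[of p q 1] subst_gy_mult[of p q 1] by (simp_all add: subst_one)

text \<open>An inverse substitution only has to be checked on the generators, by \<open>alg_hom_eqI\<close>.\<close>

lemma alg_aut_subst:
  assumes "subst p q p' = gx" "subst p q q' = gy" "subst p' q' p = gx" "subst p' q' q = gy"
  shows "alg_aut (subst p q)"
proof -
  have "subst p q \<circ> subst p' q' = id" "subst p' q' \<circ> subst p q = id"
    using assms by (auto intro!: alg_hom_eqI alg_hom_comp alg_hom_subst alg_hom_id)
  then show ?thesis
    by (auto simp: alg_aut_iff alg_hom_subst intro: o_bij)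
qed

section \<open>The group of automorphisms preserving the commutator\<close>

lemma autG_iff:
  "\<sigma> \<in> autG \<longleftrightarrow> bij \<sigma> \<and> alg_hom \<sigma> \<and> commutator (\<sigma> gx) (\<sigma> gy) = commutator gx gy"
  by (auto simp: autG_def alg_aut_iff hom_commutator)

lemma autG_hom: "\<sigma> \<in> autG \<Longrightarrow> alg_hom \<sigma>"
  by (simp add: autG_iff)

lemma autG_comp: "\<sigma> \<in> autG \<Longrightarrow> \<tau> \<in> autG \<Longrightarrow> \<sigma> \<circ> \<tau> \<in> autG"
  by (auto simp: autG_def alg_aut_iff bij_comp alg_hom_comp)

lemma alg_hom_inv:
  assumes "bij \<sigma>" "alg_hom \<sigma>"
  shows "alg_hom (inv \<sigma>)"
proof -
  have *: "inv \<sigma> u = v" if "u = \<sigma> v" for u v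
    using that assms(1) by (simp add: bij_is_inj)
  have s: "\<sigma> (inv \<sigma> u) = u" for u
    using assms(1) by (simp add: bij_is_surj surj_f_inv_f)
  show ?thesis
    unfolding alg_hom_iff by (auto intro!: * simp: hom_simps[OF assms(2)] s)
qed

lemma autG_inv:
  assumes "\<sigma> \<in> autG"
  shows "inv \<sigma> \<in> autG"
proof -
  have b: "bij \<sigma>" and h: "alg_hom \<sigma>" and c: "\<sigma> (commutator gx gy) = commutator gx gy"
    using assms by (auto simp: autG_def alg_aut_iff)
  have "inv \<sigma> (commutator gx gy) = commutator gx gy"
    using b c by (metis bij_is_inj inv_f_f)
  then show ?thesis
    using b h by (auto simp: autG_def alg_aut_iff alg_hom_inv bij_imp_bij_inv)
qed

lemma autG_comp_inv: "\<sigma> \<in> autG \<Longrightarrow> \<sigma> \<circ> inv \<sigma> = id"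
  and autG_inv_comp: "\<sigma> \<in> autG \<Longrightarrow> inv \<sigma> \<circ> \<sigma> = id"
  by (auto simp: autG_iff bij_def surj_iff[symmetric])

section \<open>Polynomial curves\<close>

text \<open>These are the maps \<open>t \<mapsto> \<Sum>\<^sub>i t\<^sup>i f\<^sub>i\<close> with finitely many terms, generated in Horner form. Closure
  properties, degree bounds and polynomiality of coefficients then follow by rule induction, without
  any manipulation of double sums.\<close>

inductive_set poly_curve :: "(complex \<Rightarrow> falg) set" where
  const: "(\<lambda>t. f) \<in> poly_curve"
| add: "\<phi> \<in> poly_curve \<Longrightarrow> \<psi> \<in> poly_curve \<Longrightarrow> (\<lambda>t. \<phi> t + \<psi> t) \<in> poly_curve"
| param: "\<phi> \<in> poly_curve \<Longrightarrow> (\<lambda>t. scale t (\<phi> t)) \<in> poly_curve"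

lemma poly_curve_mult:
  assumes "\<phi> \<in> poly_curve" "\<psi> \<in> poly_curve"
  shows "(\<lambda>t. \<phi> t * \<psi> t) \<in> poly_curve"
  using assms(1)
proof induction
  case (const f)
  show ?case
    using assms(2) by induction (auto simp: distrib_left scale_mult_right intro: poly_curve.intros)
next
  case (add \<phi>1 \<phi>2)
  then show ?case by (auto simp: distrib_right intro: poly_curve.intros)
next
  case (param \<phi>)
  then show ?case by (auto simp: scale_mult_left intro: poly_curve.intros)
qed

lemma poly_curve_scale: "\<phi> \<in> poly_curve \<Longrightarrow> (\<lambda>t. scale c (\<phi> t)) \<in> poly_curve"
  unfolding scale_conv_mult by (intro poly_curve_mult poly_curve.const)

lemma poly_curve_diff:
  assumes "\<phi> \<in> poly_curve" "\<psi> \<in> poly_curve"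
  shows "(\<lambda>t. \<phi> t - \<psi> t) \<in> poly_curve"
  using poly_curve.add[OF assms(1) poly_curve_scale[OF assms(2), of "-1"]] by simp

lemma poly_curve_reverse: "\<phi> \<in> poly_curve \<Longrightarrow> (\<lambda>t. \<phi> (1 - t)) \<in> poly_curve"
proof (induction rule: poly_curve.induct)
  case (param \<phi>)
  then have "(\<lambda>t. \<phi> (1 - t) - scale t (\<phi> (1 - t))) \<in> poly_curve"
    by (intro poly_curve_diff poly_curve.param)
  then show ?case by (simp add: falg.scale_left_diff_distrib)
qed (auto intro: poly_curve.intros)

lemma poly_curve_lookup:
  assumes "\<phi> \<in> poly_curve"
  obtains p where "\<And>t. Poly_Mapping.lookup (\<phi> t) w = poly p t"
proof -
  have "\<exists>p. \<forall>t. Poly_Mapping.lookup (\<phi> t) w = poly p t"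
    using assms
  proof induction
    case (const f)
    show ?case by (rule exI[of _ "[:Poly_Mapping.lookup f w:]"]) simp
  next
    case (add \<phi> \<psi>)
    then obtain p q where "\<forall>t. Poly_Mapping.lookup (\<phi> t) w = poly p t"
      "\<forall>t. Poly_Mapping.lookup (\<psi> t) w = poly q t" by blast
    then show ?case by (intro exI[of _ "p + q"]) (simp add: lookup_add)
  next
    case (param \<phi>)
    then obtain p where "\<forall>t. Poly_Mapping.lookup (\<phi> t) w = poly p t" by blast
    then show ?case by (intro exI[of _ "pCons 0 p"]) simp
  qed
  then show ?thesis using that by blast
qed

lemma poly_curve_bounded_degree:
  assumes "\<phi> \<in> poly_curve"
  obtains k where "\<And>t. \<phi> t \<in> R_le k"
proof -
  have "\<exists>k. \<forall>t. \<phi> t \<in> R_le k"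
    using assms
  proof induction
    case (const f)
    have "finite ((length \<circ> letters) ` Poly_Mapping.keys f)" by simp
    then show ?case unfolding R_le_def finite_nat_set_iff_bounded_le by auto
  next
    case (add \<phi> \<psi>)
    then obtain k l where "\<forall>t. \<phi> t \<in> R_le k" "\<forall>t. \<psi> t \<in> R_le l" by blast
    then have "\<phi> t + \<psi> t \<in> R_le (max k l)" for t
      using Poly_Mapping.keys_add[of "\<phi> t" "\<psi> t"] unfolding R_le_def by fastforce
    then show ?case by blast
  next
    case (param \<phi>)
    then obtain k where "\<forall>t. \<phi> t \<in> R_le k" by blast
    then have "scale t (\<phi> t) \<in> R_le k" for t
      by (auto simp: R_le_def in_keys_iff)
    then show ?case by blast
  qed
  then show ?thesis using that by blast
qed

text \<open>Zariski density of the punctured line: each coefficient is a polynomial in the parameter, and a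
  polynomial with infinitely many zeros vanishes.\<close>

lemma poly_curve_eq_at_zero:
  assumes "\<phi> \<in> poly_curve" and eq: "\<And>t. t \<noteq> 0 \<Longrightarrow> \<phi> t = f"
  shows "\<phi> 0 = f"
proof (rule poly_mapping_eqI)
  fix w
  obtain p where p: "\<And>t. Poly_Mapping.lookup (\<phi> t) w = poly p t"
    using poly_curve_lookup[OF assms(1)] by blast
  let ?q = "p - [:Poly_Mapping.lookup f w:]"
  have "UNIV - {0} \<subseteq> {t. poly ?q t = 0}"
    using eq p by fastforce
  moreover have "infinite (UNIV - {0::complex})"
    by (simp add: infinite_UNIV_char_0)
  ultimately have "?q = 0"
    using poly_roots_finite finite_subset by blast
  then show "Poly_Mapping.lookup (\<phi> 0) w = Poly_Mapping.lookup f w"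
    using p[of 0] by simp
qed

definition aut_curve :: "(complex \<Rightarrow> falg \<Rightarrow> falg) \<Rightarrow> bool" where
  "aut_curve \<Phi> \<longleftrightarrow> (\<forall>t. \<Phi> t \<in> autG) \<and> (\<forall>f. (\<lambda>t. \<Phi> t f) \<in> poly_curve)"

lemma hom_curve_from_generators:
  assumes hom: "\<And>t. alg_hom (\<Phi> t)"
    and x: "(\<lambda>t. \<Phi> t gx) \<in> poly_curve" and y: "(\<lambda>t. \<Phi> t gy) \<in> poly_curve"
  shows "(\<lambda>t. \<Phi> t f) \<in> poly_curve"
  by (induction f rule: falg_induct)
    (simp_all add: hom_simps[OF hom] poly_curve_mult x y poly_curve.intros)

text \<open>Both the automorphism and its argument may depend on the parameter. This is what makes
  composition of curves of automorphisms polynomial.\<close>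

lemma aut_curve_apply:
  assumes "aut_curve \<Phi>" "\<phi> \<in> poly_curve"
  shows "(\<lambda>t. \<Phi> t (\<phi> t)) \<in> poly_curve"
proof -
  have hom: "alg_hom (\<Phi> t)" for t
    using assms(1) by (simp add: aut_curve_def autG_hom)
  show ?thesis
    using assms(2)
  proof induction
    case (const f)
    show ?case using assms(1) by (simp add: aut_curve_def)
  qed (simp_all add: hom_simps[OF hom] poly_curve.intros)
qed

text \<open>One line suffices here instead of a chain: thanks to the group structure the relation is
  transitive, see \<open>joined_trans\<close>.\<close>

definition joined :: "(falg \<Rightarrow> falg) \<Rightarrow> (falg \<Rightarrow> falg) \<Rightarrow> bool" where
  "joined \<sigma> \<tau> \<longleftrightarrow> (\<exists>\<Phi>. aut_curve \<Phi> \<and> \<Phi> 0 = \<sigma> \<and> \<Phi> 1 = \<tau>)"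

lemma joined_autG: "joined \<sigma> \<tau> \<Longrightarrow> \<sigma> \<in> autG \<and> \<tau> \<in> autG"
  by (auto simp: joined_def aut_curve_def)

lemma joined_refl: "\<sigma> \<in> autG \<Longrightarrow> joined \<sigma> \<sigma>"
  unfolding joined_def aut_curve_def by (rule exI[of _ "\<lambda>_. \<sigma>"]) (simp add: poly_curve.const)

lemma joined_sym:
  assumes "joined \<sigma> \<tau>"
  shows "joined \<tau> \<sigma>"
proof -
  obtain \<Phi> where "aut_curve \<Phi>" "\<Phi> 0 = \<sigma>" "\<Phi> 1 = \<tau>"
    using assms by (auto simp: joined_def)
  then have "aut_curve (\<lambda>t. \<Phi> (1 - t))"
    by (auto simp: aut_curve_def intro: poly_curve_reverse)
  then show ?thesis
    unfolding joined_def using \<open>\<Phi> 0 = \<sigma>\<close> \<open>\<Phi> 1 = \<tau>\<close>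
    by (intro exI[of _ "\<lambda>t. \<Phi> (1 - t)"]) simp
qed

lemma joined_comp:
  assumes "joined \<sigma> \<tau>" "joined \<sigma>' \<tau>'"
  shows "joined (\<sigma> \<circ> \<sigma>') (\<tau> \<circ> \<tau>')"
proof -
  obtain \<Phi> where \<Phi>: "aut_curve \<Phi>" "\<Phi> 0 = \<sigma>" "\<Phi> 1 = \<tau>"
    using assms(1) by (auto simp: joined_def)
  obtain \<Psi> where \<Psi>: "aut_curve \<Psi>" "\<Psi> 0 = \<sigma>'" "\<Psi> 1 = \<tau>'"
    using assms(2) by (auto simp: joined_def)
  have "aut_curve (\<lambda>t. \<Phi> t \<circ> \<Psi> t)"
    unfolding aut_curve_def
    using \<Phi>(1) \<Psi>(1) aut_curve_apply[OF \<Phi>(1)] by (auto simp: aut_curve_def autG_comp)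
  then show ?thesis
    unfolding joined_def using \<Phi> \<Psi> by (intro exI[of _ "\<lambda>t. \<Phi> t \<circ> \<Psi> t"]) simp
qed

text \<open>Two lines, from \<open>\<sigma>\<close> to \<open>\<tau>\<close> and from \<open>\<tau>\<close> to \<open>\<rho>\<close>, are merged by multiplying them with
  \<open>\<tau>\<^sup>-\<^sup>1\<close> in between: \<open>\<Phi>\<^sub>t \<circ> \<tau>\<^sup>-\<^sup>1 \<circ> \<Psi>\<^sub>t\<close> runs from \<open>\<sigma>\<close> to \<open>\<rho>\<close>.\<close>

lemma joined_trans:
  assumes "joined \<sigma> \<tau>" "joined \<tau> \<rho>"
  shows "joined \<sigma> \<rho>"
proof -
  have \<tau>: "\<tau> \<in> autG" using assms joined_autG by blast
  have "joined (\<sigma> \<circ> inv \<tau> \<circ> \<tau>) (\<tau> \<circ> inv \<tau> \<circ> \<rho>)"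
    by (intro joined_comp assms joined_refl autG_inv \<tau>)
  then show ?thesis
    by (simp add: comp_assoc autG_inv_comp[OF \<tau>])
      (simp add: comp_assoc[symmetric] autG_comp_inv[OF \<tau>])
qed

section \<open>Connecting every automorphism to the identity\<close>

lemma joined_comp_id: "joined id \<sigma> \<Longrightarrow> joined id \<tau> \<Longrightarrow> joined id (\<sigma> \<circ> \<tau>)"
  using joined_comp[of id \<sigma> id \<tau>] by simp

definition translation :: "complex \<Rightarrow> complex \<Rightarrow> falg \<Rightarrow> falg" where
  "translation a b = subst (gx + scale a 1) (gy + scale b 1)"

lemma joined_translation: "joined id (translation a b)"
proof -
  have "translation a b \<in> autG" for a b
  proof -
    have "alg_aut (translation a b)"
      unfolding translation_def
      by (rule alg_aut_subst[of _ _ "gx - scale a 1" "gy - scale b 1"])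
        (simp_all add: hom_simps[OF alg_hom_subst])
    then show ?thesis
      by (simp add: autG_iff alg_aut_iff)
        (simp add: translation_def commutator_def algebra_simps scale_mult_left scale_mult_right)
  qed
  moreover have "(\<lambda>t. translation (t * a) (t * b) f) \<in> poly_curve" for f
    by (rule hom_curve_from_generators)
      (auto simp: translation_def alg_hom_subst falg.scale_scale[symmetric]
        simp del: falg.scale_scale intro!: poly_curve.intros)
  moreover have "translation 0 0 = id"
    by (rule alg_hom_eqI) (simp_all add: translation_def alg_hom_subst alg_hom_id)
  ultimately show ?thesis
    unfolding joined_def aut_curve_def
    by (intro exI[of _ "\<lambda>t. translation (t * a) (t * b)"]) simp
qed

definition lin :: "complex \<Rightarrow> complex \<Rightarrow> complex \<Rightarrow> complex \<Rightarrow> falg \<Rightarrow> falg" where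
  "lin a b c d = subst (scale a gx + scale b gy) (scale c gx + scale d gy)"

text \<open>Substitution is contravariant in the matrix: the matrix of the composite is the product in the
  opposite order.\<close>

lemma lin_comp:
  "lin a b c d \<circ> lin a' b' c' d' =
   lin (a' * a + b' * c) (a' * b + b' * d) (c' * a + d' * c) (c' * b + d' * d)"
  by (rule alg_hom_eqI)
    (simp_all add: lin_def alg_hom_subst alg_hom_comp hom_simps[OF alg_hom_subst]
      falg.scale_left_distrib falg.scale_right_distrib algebra_simps)

lemma lin_id: "lin 1 0 0 1 = id"
  by (rule alg_hom_eqI) (simp_all add: lin_def alg_hom_subst alg_hom_id)

lemma bij_lin:
  assumes "a * d - b * c \<noteq> 0"
  shows "bij (lin a b c d)"
proof -
  define D where "D = a * d - b * c"
  have D: "D \<noteq> 0" "D = a * d - b * c" using assms by (simp_all add: D_def)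
  have "lin a b c d \<circ> lin (d / D) (- b / D) (- c / D) (a / D) = id"
    "lin (d / D) (- b / D) (- c / D) (a / D) \<circ> lin a b c d = id"
    unfolding lin_comp lin_id[symmetric] using D(1)
    by (simp_all add: field_simps) (simp_all add: D(2) algebra_simps)
  then show ?thesis by (auto intro: o_bij)
qed

text \<open>Since the commutator is nonzero, linear substitutions preserve it precisely when their
  determinant is \<open>1\<close>.\<close>

lemma lin_commutator:
  "commutator (lin a b c d gx) (lin a b c d gy) = scale (a * d - b * c) (commutator gx gy)"
  by (simp add: lin_def commutator_def distrib_left distrib_right scale_mult_left scale_mult_right
      falg.scale_left_diff_distrib falg.scale_right_diff_distrib falg.scale_right_distrib
      algebra_simps)

lemma lin_autG: "a * d - b * c = 1 \<Longrightarrow> lin a b c d \<in> autG"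
  using bij_lin[of a d b c] lin_commutator[of a b c d]
  by (simp add: autG_iff) (simp add: lin_def alg_hom_subst)

lemma joined_elementary: "joined id (lin 1 s 0 1)" "joined id (lin 1 0 s 1)"
proof -
  have "(\<lambda>t. lin 1 (t * s) 0 1 f) \<in> poly_curve" "(\<lambda>t. lin 1 0 (t * s) 1 f) \<in> poly_curve" for f
    by (rule hom_curve_from_generators;
      auto simp: lin_def alg_hom_subst falg.scale_scale[symmetric]
        simp del: falg.scale_scale intro!: poly_curve.intros)+
  then have "aut_curve (\<lambda>t. lin 1 (t * s) 0 1)" "aut_curve (\<lambda>t. lin 1 0 (t * s) 1)"
    by (simp_all add: aut_curve_def lin_autG)
  then show "joined id (lin 1 s 0 1)" "joined id (lin 1 0 s 1)"
    unfolding joined_def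
    by (intro exI[of _ "\<lambda>t. lin 1 (t * s) 0 1"] exI[of _ "\<lambda>t. lin 1 0 (t * s) 1"];
      simp add: lin_id)+
qed

text \<open>If the upper right entry is nonzero, the matrix is lower times upper times lower triangular, each
  factor unipotent. Otherwise the diagonal entries are nonzero, and adding the first column to the
  second reduces to that case.\<close>

lemma joined_lin:
  assumes det: "a * d - b * c = 1"
  shows "joined id (lin a b c d)"
proof -
  have main: "joined id (lin a b c d)" if det: "a * d - b * c = 1" and b: "b \<noteq> 0" for a b c d
  proof -
    \<comment> \<open>The diagonal entries of the product of the three factors determine \<open>u\<close> and \<open>v\<close>; the
      determinant then takes care of \<open>c\<close>.\<close>
    define u v where "u = (d - 1) / b" and "v = (a - 1) / b"
    have a: "a = 1 + b * v" and d: "d = 1 + b * u"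
      using b by (simp_all add: u_def v_def)
    have "b * c = b * (u + v + u * b * v)"
      using det unfolding a d by algebra
    then have c: "c = u + v + u * b * v"
      using b by simp
    have "joined id (lin 1 0 v 1 \<circ> lin 1 b 0 1 \<circ> lin 1 0 u 1)"
      by (intro joined_comp_id joined_elementary)
    then show ?thesis
      by (simp add: lin_comp a c d algebra_simps)
  qed
  show ?thesis
  proof (cases "b = 0")
    case True
    then have "a \<noteq> 0" using det by auto
    then have "joined id (lin a a c (c + d))"
      using det True by (intro main) (simp_all add: algebra_simps)
    then have "joined id (lin 1 (-1) 0 1 \<circ> lin a a c (c + d))"
      by (intro joined_comp_id joined_elementary)
    then show ?thesis
      using True by (simp add: lin_comp)
  qed (use main det in blast)
qed

definition dilation :: "complex \<Rightarrow> falg \<Rightarrow> falg" where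
  "dilation t = subst (scale t gx) (scale t gy)"

lemma alg_hom_dilation: "alg_hom (dilation t)"
  by (simp add: dilation_def alg_hom_subst)

lemma dilation_gx [simp]: "dilation t gx = scale t gx"
  and dilation_gy [simp]: "dilation t gy = scale t gy"
  by (simp_all add: dilation_def)

lemma dilation_curve: "(\<lambda>t. dilation t f) \<in> poly_curve"
  by (rule hom_curve_from_generators)
    (simp_all add: alg_hom_dilation poly_curve.intros)

lemma dilation_inverse: "t \<noteq> 0 \<Longrightarrow> dilation t \<circ> dilation (1 / t) = id"
  by (rule alg_hom_eqI)
    (simp_all add: alg_hom_comp alg_hom_dilation alg_hom_id hom_simps[OF alg_hom_dilation])

lemma bij_dilation:
  assumes "t \<noteq> 0"
  shows "bij (dilation t)"
  using dilation_inverse[of t] dilation_inverse[of "1 / t"] assms by (auto intro: o_bij)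

text \<open>The dilation with parameter zero is the augmentation, which picks out the constant term.\<close>

lemma dilation_zero: obtains c where "dilation 0 f = scale c 1"
proof -
  obtain c f1 f2 where "f = scale c 1 + gx * f1 + gy * f2"
    by (rule falg_decompose)
  then have "dilation 0 f = scale c 1"
    by (simp add: hom_simps[OF alg_hom_dilation])
  then show ?thesis by (rule that)
qed

text \<open>The Alexander trick. The hypotheses on \<^term>\<open>\<sigma>\<close> say that the images of the generators have no
  constant term. Conjugation by dilations deforms \<^term>\<open>\<sigma>\<close> into its linear part.\<close>

lemma joined_id_origin_preserving:
  assumes \<sigma>: "\<sigma> \<in> autG"
    and x: "\<sigma> gx = gx * p1 + gy * p2" and y: "\<sigma> gy = gx * q1 + gy * q2"
  shows "joined id \<sigma>"
proof -
  \<comment> \<open>These are the images of the generators under the conjugate, with the factor \<open>1 / t\<close> cancelled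
    against the split-off letter; hence they make sense at \<open>t = 0\<close> as well.\<close>
  define px where "px t = gx * dilation t p1 + gy * dilation t p2" for t
  define py where "py t = gx * dilation t q1 + gy * dilation t q2" for t
  define \<Phi> where "\<Phi> t = subst (px t) (py t)" for t
  have hom: "alg_hom (\<Phi> t)" for t
    by (simp add: \<Phi>_def alg_hom_subst)
  have pcurve: "px \<in> poly_curve" "py \<in> poly_curve"
    unfolding px_def py_def
    by (intro poly_curve.add poly_curve_mult poly_curve.const dilation_curve)+
  have conj: "\<Phi> t = dilation t \<circ> \<sigma> \<circ> dilation (1 / t)" if "t \<noteq> 0" for t
    by (rule alg_hom_eqI)
      (use that in \<open>simp_all add: alg_hom_subst \<Phi>_def px_def py_def alg_hom_comp alg_hom_dilation
        autG_hom[OF \<sigma>] hom_simps[OF alg_hom_dilation] hom_simps[OF autG_hom[OF \<sigma>]] x y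
        scale_mult_left falg.scale_right_distrib\<close>)
  have nonzero: "\<Phi> t \<in> autG" if "t \<noteq> 0" for t
  proof -
    have "bij (\<Phi> t)"
      using \<sigma> that unfolding conj[OF that] by (intro bij_comp bij_dilation) (auto simp: autG_iff)
    moreover have "\<Phi> t (commutator gx gy) = commutator gx gy"
    proof -
      have *: "commutator (scale c gx) (scale c gy) = scale (c * c) (commutator gx gy)" for c
        by (simp add: commutator_def scale_mult_left scale_mult_right
            falg.scale_right_diff_distrib)
      have "\<sigma> (commutator gx gy) = commutator gx gy"
        using \<sigma> by (simp add: autG_def)
      then show ?thesis
        unfolding conj[OF that] using that
        by (simp add: hom_commutator[OF alg_hom_dilation] * hom_scale[OF alg_hom_dilation]
            hom_scale[OF autG_hom[OF \<sigma>]])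
    qed
    ultimately show ?thesis by (simp add: autG_def alg_aut_iff hom)
  qed
  obtain a b c d where abcd: "dilation 0 p1 = scale a 1" "dilation 0 p2 = scale b 1"
    "dilation 0 q1 = scale c 1" "dilation 0 q2 = scale d 1"
    using dilation_zero by metis
  have zero: "\<Phi> 0 = lin a b c d"
    by (simp add: \<Phi>_def px_def py_def lin_def abcd scale_mult_right)
  \<comment> \<open>Preservation of the commutator passes to the limit \<open>t = 0\<close> and forces determinant \<open>1\<close>.\<close>
  have "commutator (px 0) (py 0) = commutator gx gy"
  proof (rule poly_curve_eq_at_zero)
    show "(\<lambda>t. commutator (px t) (py t)) \<in> poly_curve"
      unfolding commutator_def by (intro poly_curve_diff poly_curve_mult pcurve)
    show "commutator (px t) (py t) = commutator gx gy" if "t \<noteq> 0" for t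
      using nonzero[OF that] by (simp add: autG_iff \<Phi>_def)
  qed
  moreover have "px 0 = lin a b c d gx" "py 0 = lin a b c d gy"
    unfolding zero[symmetric] by (simp_all add: \<Phi>_def)
  ultimately have "scale (a * d - b * c) (commutator gx gy) = scale 1 (commutator gx gy)"
    by (simp add: lin_commutator)
  moreover have "commutator gx gy \<noteq> 0"
  proof -
    have "Poly_Mapping.lookup (commutator gx gy) (Mon [Lx, Ly]) = 1"
      by (simp add: commutator_def gx_def gy_def mult_single plus_mon_def lookup_minus lookup_single)
    then show ?thesis by auto
  qed
  ultimately have det: "a * d - b * c = 1"
    by (simp only: falg.scale_right_imp_eq)
  have "\<Phi> t \<in> autG" for t
    using nonzero[of t] lin_autG[OF det] zero by (cases "t = 0") auto
  moreover have "(\<lambda>t. \<Phi> t f) \<in> poly_curve" for f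
    by (rule hom_curve_from_generators[OF hom]) (simp_all add: \<Phi>_def pcurve)
  moreover have "\<Phi> 1 = \<sigma>"
  proof -
    have "dilation 1 = id"
      by (rule alg_hom_eqI) (simp_all add: alg_hom_dilation alg_hom_id)
    then show ?thesis using conj[of 1] by simp
  qed
  ultimately have "joined (lin a b c d) \<sigma>"
    unfolding joined_def aut_curve_def using zero by blast
  then show ?thesis
    using joined_lin[OF det] joined_trans by blast
qed

lemma joined_id:
  assumes \<sigma>: "\<sigma> \<in> autG"
  shows "joined id \<sigma>"
proof -
  obtain a p1 p2 where x: "\<sigma> gx = scale a 1 + gx * p1 + gy * p2"
    by (rule falg_decompose)
  obtain b q1 q2 where y: "\<sigma> gy = scale b 1 + gx * q1 + gy * q2"
    by (rule falg_decompose)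
  let ?\<tau> = "translation (- a) (- b)"
  have \<tau>: "joined id ?\<tau>" by (rule joined_translation)
  have "\<sigma> \<circ> ?\<tau> \<in> autG"
    using \<sigma> \<tau> by (blast intro: autG_comp dest: joined_autG)
  then have "joined id (\<sigma> \<circ> ?\<tau>)"
    by (rule joined_id_origin_preserving) (simp_all add: translation_def hom_simps[OF autG_hom[OF \<sigma>]] x y)
  moreover have "joined \<sigma> (\<sigma> \<circ> ?\<tau>)"
    using joined_comp[OF joined_refl[OF \<sigma>] \<tau>] by simp
  ultimately show ?thesis
    using joined_sym joined_trans by blast
qed

section \<open>Irreducibility\<close>

lemma poly_fun_along_curve:
  assumes "P \<in> poly_fun k" "\<phi> \<in> poly_curve" "\<psi> \<in> poly_curve"
  obtains p where "\<And>t. P (\<phi> t, \<psi> t) = poly p t"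
proof -
  have "\<exists>p. \<forall>t. P (\<phi> t, \<psi> t) = poly p t"
    using assms(1)
  proof induction
    case (const c)
    show ?case by (rule exI[of _ "[:c:]"]) simp
  next
    case (coord_fst w)
    show ?case using poly_curve_lookup[OF assms(2), of w] by (metis fst_conv)
  next
    case (coord_snd w)
    show ?case using poly_curve_lookup[OF assms(3), of w] by (metis snd_conv)
  next
    case (add P Q)
    then show ?case by (metis poly_add)
  next
    case (mult P Q)
    then show ?case by (metis poly_mult)
  qed
  then show ?thesis using that by blast
qed

lemma G_curve:
  assumes "g \<in> G" "h \<in> G"
  obtains \<phi> \<psi> where "\<phi> \<in> poly_curve" "\<psi> \<in> poly_curve" "\<And>t. (\<phi> t, \<psi> t) \<in> G"
    "(\<phi> 0, \<psi> 0) = g" "(\<phi> 1, \<psi> 1) = h"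
proof -
  obtain \<sigma> \<tau> where \<sigma>: "\<sigma> \<in> autG" "g = (\<sigma> gx, \<sigma> gy)" and \<tau>: "\<tau> \<in> autG" "h = (\<tau> gx, \<tau> gy)"
    using assms by (auto simp: G_def)
  have "joined \<sigma> \<tau>"
    using joined_id[OF \<sigma>(1)] joined_id[OF \<tau>(1)] joined_sym joined_trans by blast
  then obtain \<Phi> where "aut_curve \<Phi>" "\<Phi> 0 = \<sigma>" "\<Phi> 1 = \<tau>"
    by (auto simp: joined_def)
  then show ?thesis
    using \<sigma> \<tau> by (intro that[of "\<lambda>t. \<Phi> t gx" "\<lambda>t. \<Phi> t gy"]) (auto simp: aut_curve_def G_def)
qed

lemma ind_closed_separating_function:
  assumes "ind_closed A" "g \<in> G_le k" "g \<notin> A"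
  obtains P where "P \<in> poly_fun k" "P g \<noteq> 0" "\<And>a. a \<in> A \<inter> G_le k \<Longrightarrow> P a = 0"
proof -
  obtain Z where Z: "zariski_closed k Z" "A \<inter> G_le k = Z \<inter> G_le k"
    using assms(1) unfolding ind_closed_def closedin_subtopology closedin_zariski by blast
  then obtain F where F: "F \<subseteq> poly_fun k" "Z = zero_locus k F"
    by (auto simp: zariski_closed_def)
  have "g \<notin> Z" "g \<in> V_le k"
    using assms Z(2) by (auto simp: G_le_def)
  then obtain P where "P \<in> F" "P g \<noteq> 0"
    using F(2) by (auto simp: zero_locus_def)
  then show ?thesis
    using F Z(2) by (intro that[of P]) (auto simp: zero_locus_def)
qed

lemma irreducible_imp_connected:
  assumes "irreducible_space T"
  shows "connected_space T"
  using assms unfolding connected_space_closedin_eq irreducible_space_def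
  by blast

lemma irreducible_G: "irreducible_space ind_zariski_G"
  unfolding irreducible_space_def topspace_ind_zariski_G closedin_ind_zariski_G
proof (intro conjI allI impI)
  show "G \<noteq> {}" using G_nonempty by blast
next
  fix A B assume AB: "ind_closed A \<and> ind_closed B \<and> A \<union> B = G"
  show "A = G \<or> B = G"
  proof (rule ccontr)
    assume "\<not> (A = G \<or> B = G)"
    then obtain g h where g: "g \<in> G" "g \<notin> A" and h: "h \<in> G" "h \<notin> B"
      using AB by blast
    obtain \<phi> \<psi> where c: "\<phi> \<in> poly_curve" "\<psi> \<in> poly_curve" and inG: "\<And>t. (\<phi> t, \<psi> t) \<in> G"
      and ends: "(\<phi> 0, \<psi> 0) = g" "(\<phi> 1, \<psi> 1) = h"
      using G_curve[OF g(1) h(1)] by blast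
    obtain k l where "\<And>t. \<phi> t \<in> R_le k" "\<And>t. \<psi> t \<in> R_le l"
      using poly_curve_bounded_degree c by metis
    then have V: "(\<phi> t, \<psi> t) \<in> G_le (max k l)" for t
      using inG[of t] by (fastforce simp: G_le_def V_le_def R_le_def)
    then have gh: "g \<in> G_le (max k l)" "h \<in> G_le (max k l)"
      using ends by metis+
    obtain P where P: "P \<in> poly_fun (max k l)" "P g \<noteq> 0"
        "\<And>a. a \<in> A \<inter> G_le (max k l) \<Longrightarrow> P a = 0"
      using ind_closed_separating_function[OF conjunct1[OF AB] gh(1) g(2)] by blast
    obtain Q where Q: "Q \<in> poly_fun (max k l)" "Q h \<noteq> 0"
        "\<And>a. a \<in> B \<inter> G_le (max k l) \<Longrightarrow> Q a = 0"
      using ind_closed_separating_function[OF conjunct1[OF conjunct2[OF AB]] gh(2) h(2)] by blast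
    obtain p where p: "\<And>t. P (\<phi> t, \<psi> t) = poly p t"
      using poly_fun_along_curve[OF P(1) c] by blast
    obtain q where q: "\<And>t. Q (\<phi> t, \<psi> t) = poly q t"
      using poly_fun_along_curve[OF Q(1) c] by blast
    have "poly (p * q) t = 0" for t
      using P(3)[of "(\<phi> t, \<psi> t)"] Q(3)[of "(\<phi> t, \<psi> t)"] V[of t] inG[of t] AB p[of t] q[of t]
      by auto
    then have "p * q = 0"
      using poly_all_0_iff_0 by blast
    then have "p = 0 \<or> q = 0" by simp
    then show False
      using p[of 0] q[of 1] P(2) Q(2) ends by auto
  qed
qed

theorem theorem13:
  shows "connected_space ind_zariski_G \<and> irreducible_space ind_zariski_G"
  using irreducible_G irreducible_imp_connected by blast

end
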